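(* A unipotent map $G\colon\mathbb{R}^2\to\mathbb{R}^2$ of class $C^1$ has no isolated fixed points; that is, the set $\{z\in\mathbb{R}^2 : G(z)=z\}$ has no isolated points.
   Context: A differentiable map $G\colon\mathbb{R}^2\to\mathbb{R}^2$ is called unipotent if its spectrum $\mathrm{Spc}(G)=\{\text{eigenvalues of } DG_z : z\in\mathbb{R}^2\}\subset\mathbb{C}$ is the set $\{1\}$. *)

theory Defs
  imports "HOL-Analysis.Analysis"
begin

text \<open>Eigenvalues of a real matrix are taken over the complex numbers: the eigenvectors
  range over the complexification of the underlying space.\<close>

definition complex_eigenvalue :: "real ^ 'n ^ 'n \<Rightarrow> complex \<Rightarrow> bool" where
  "complex_eigenvalue A \<mu> \<longleftrightarrow>
     (\<exists>v :: complex ^ 'n. v \<noteq> 0 \<and> map_matrix complex_of_real A *v v = \<mu> *s v)"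

text \<open>The Jacobian matrix has unspecified entries where the map is not differentiable, so
  \<open>Spc\<close> is meaningful only for everywhere differentiable maps.\<close>

definition Spc :: "(real ^ 'n \<Rightarrow> real ^ 'n) \<Rightarrow> complex set" where
  "Spc G = {\<mu>. \<exists>z. complex_eigenvalue (jacobian G (at z)) \<mu>}"

definition unipotent :: "(real ^ 2 \<Rightarrow> real ^ 2) \<Rightarrow> bool" where
  "unipotent G \<longleftrightarrow> (\<forall>z. G differentiable (at z)) \<and> Spc G = {1}"

definition class_C1 :: "(real ^ 'n \<Rightarrow> real ^ 'm) \<Rightarrow> bool" where
  "class_C1 G \<longleftrightarrow>
     (\<forall>z. G differentiable (at z)) \<and> continuous_on UNIV (\<lambda>z. jacobian G (at z))"

end

theory Submission
  imports Defs
begin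

text \<open>Subtracting the identity turns a unipotent map \<open>G\<close> into a map \<open>F\<close> with nilpotent derivative,
  and fixed points of \<open>G\<close> into zeros of \<open>F\<close>. The theorem follows by comparing areas. Let \<open>a\<close> be
  an isolated zero of \<open>F\<close>, say the only one in the closed disc of radius \<open>r\<close> about \<open>a\<close>, and let
  \<open>m > 0\<close> be a lower bound of \<open>norm (F x)\<close> on the boundary circle. Consider
  \<open>f x = F x + e *\<^sub>R (x - a)\<close> with a small \<open>e > 0\<close>. Nilpotency of the derivative of \<open>F\<close> says
  that the Jacobian determinant of \<open>f\<close> is the constant \<open>e\<^sup>2\<close>. This has two effects that exclude
  each other.

  First, the determinant is nonzero, so \<open>f\<close> is an open map. Since \<open>f a = 0\<close> and
  \<open>norm (f x) \<ge> m - e * r\<close> on the circle, the image of the disc contains the whole disc of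
  radius \<open>m - e * r\<close> about the origin (\<open>ball_subset_image_ball\<close>). Second, the determinant is
  small: the image has area at most \<open>e\<^sup>2\<close> times that of the disc, that is, at most the area of
  a disc of radius \<open>e * r\<close>. With \<open>e * r = m / 3\<close>, a disc of radius \<open>2 * m / 3\<close> would have at most
  the area of a disc of radius \<open>m / 3\<close>.

  The argument works in every dimension (\<open>zero_not_isolated_if_derivative_nilpotent\<close>). The
  plane enters only in the passage from the spectrum to the determinant
  (\<open>det_shift_if_only_eigenvalue_1\<close>), where the characteristic polynomial is quadratic.\<close>

text \<open>Inside the ball of radius \<open>s\<close> about \<open>f a\<close>, the image of the open ball is the same as the image
  of the compact closed ball, because the sphere is mapped outside. So its trace there is both
  open and closed, and connectedness of the ball forces the trace to be everything.\<close>

lemma ball_subset_image_ball: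
  fixes f :: "'a::euclidean_space \<Rightarrow> 'b::euclidean_space"
  assumes contf: "continuous_on (cball a r) f"
    and openf: "open (f ` ball a r)"
    and "r > 0"
    and far: "\<And>x. x \<in> sphere a r \<Longrightarrow> s \<le> dist (f a) (f x)"
  shows "ball (f a) s \<subseteq> f ` ball a r"
proof (cases "s > 0")
  case True
  let ?B = "ball (f a) s" and ?V = "f ` ball a r"
  have trace: "?B \<inter> ?V = ?B \<inter> f ` cball a r"
  proof -
    have "x \<in> ball a r" if "x \<in> cball a r" "f x \<in> ?B" for x
      using that far[of x] by (cases "x \<in> sphere a r") auto
    then show ?thesis
      using ball_subset_cball by blast
  qed
  have "closed (f ` cball a r)"
    using compact_continuous_image[OF contf] by (simp add: compact_imp_closed)
  then have "closedin (top_of_set ?B) (?B \<inter> ?V)"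
    unfolding trace by (rule closedin_closed_Int)
  moreover have "openin (top_of_set ?B) (?B \<inter> ?V)"
    using openf by (rule openin_open_Int)
  moreover have "f a \<in> ?B \<inter> ?V"
    using True \<open>r > 0\<close> by auto
  ultimately have "?B \<inter> ?V = ?B"
    using connected_ball[of "f a" s] unfolding connected_clopen by blast
  then show ?thesis
    by blast
next
  case False
  then have "ball (f a) s = {}"
    by simp
  then show ?thesis
    by blast
qed

text \<open>Openness holds point by point: Sussmann's theorem makes \<open>f x\<close> an interior point of the image
  once the derivative at \<open>x\<close> has a right inverse, here the inverse matrix.\<close>

lemma open_image_of_invertible_derivative:
  fixes f :: "real ^ 'n \<Rightarrow> real ^ 'n"
  assumes "open S"
    and der: "\<And>x. x \<in> S \<Longrightarrow> (f has_derivative f' x) (at x)"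
    and nz: "\<And>x. x \<in> S \<Longrightarrow> det (matrix (f' x)) \<noteq> 0"
  shows "open (f ` S)"
proof -
  have "f x \<in> interior (f ` S)" if x: "x \<in> S" for x
  proof -
    have lin: "linear (f' x)"
      using der[OF x] by (rule has_derivative_linear)
    then obtain B where B: "matrix (f' x) ** B = mat 1"
      using nz[OF x] invertible_det_nz invertible_def by blast
    have "f' x \<circ> (*v) B = (*v) (matrix (f' x)) \<circ> (*v) B"
      using lin by (simp add: matrix_vector_mul)
    also have "\<dots> = id"
      using B by (simp add: fun_eq_iff matrix_vector_mul_assoc)
    finally have "f' x \<circ> (*v) B = id" .
    moreover have "continuous_on S f"
      using der by (meson continuous_at_imp_continuous_on has_derivative_continuous)
    moreover have "bounded_linear ((*v) B)"
      by (rule matrix_vector_mul_bounded_linear)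
    ultimately show ?thesis
      using sussmann_open_mapping[OF \<open>open S\<close> _ x der[OF x], of "(*v) B" S]
        x \<open>open S\<close> by (simp add: interior_open)
  qed
  then have "f ` S \<subseteq> interior (f ` S)"
    by blast
  then show ?thesis
    by (metis interior_subset open_interior subset_antisym)
qed

text \<open>The assumption on determinants is nilpotency of the derivative, written through its
  characteristic polynomial. It gives the perturbation of \<open>F\<close> by a small multiple \<open>e\<close> of the
  identity a Jacobian determinant that is nonzero, so that images of balls are large, but of order
  \<open>e ^ CARD('n)\<close>, so that their volumes are small.\<close>

lemma zero_not_isolated_if_derivative_nilpotent:
  fixes F :: "real ^ 'n::{finite,wellorder} \<Rightarrow> real ^ 'n::_"
  assumes der: "\<And>x. (F has_derivative F' x) (at x)"
    and det: "\<And>x e. e > 0 \<Longrightarrow> det (matrix (F' x) + e *\<^sub>R mat 1) = e ^ CARD('n)"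
  shows "\<not> a isolated_in {x. F x = 0}"
proof
  assume "a isolated_in {x. F x = 0}"
  then obtain T where T: "open T" "T \<inter> {x. F x = 0} = {a}"
    unfolding isolated_in_def by blast
  then have Fa: "F a = 0" and "a \<in> T"
    by auto
  then obtain r where r: "r > 0" "cball a r \<subseteq> T"
    using T open_contains_cball by blast
  have contF: "continuous_on S F" for S
    using der by (meson continuous_at_imp_continuous_on has_derivative_continuous)
  have "0 \<notin> F ` sphere a r"
    using r T by force
  moreover have "closed (F ` sphere a r)"
    by (intro compact_imp_closed compact_continuous_image contF) auto
  ultimately have "\<exists>m>0. \<forall>y\<in>F ` sphere a r. m \<le> dist 0 y"
    by (intro separate_point_closed)
  then obtain m where m: "m > 0" "\<And>y. y \<in> F ` sphere a r \<Longrightarrow> m \<le> dist 0 y"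
    by blast
  \<comment> \<open>Any \<open>e\<close> with \<open>0 < e * r < m / 2\<close> would serve: the volume bound needs \<open>e * r < m - e * r\<close>.\<close>
  define e where "e = m / (3 * r)"
  have e: "e > 0" "e * r = m / 3"
    using m r by (auto simp: e_def)
  define f where "f = (\<lambda>x. F x + e *\<^sub>R (x - a))"
  define f' where "f' = (\<lambda>x h. F' x h + e *\<^sub>R h)"
  have derf: "(f has_derivative f' x) (at x)" for x
    unfolding f_def f'_def by (auto intro!: derivative_eq_intros der)
  have "matrix (f' x) = matrix (F' x) + e *\<^sub>R mat 1" for x
    by (simp add: f'_def matrix_def vec_eq_iff mat_def axis_def)
  then have detf: "det (matrix (f' x)) = e ^ CARD('n)" for x
    using det e by simp
  have fa: "f a = 0"
    by (simp add: f_def Fa)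
  have "ball (f a) (2 * m / 3) \<subseteq> f ` ball a r"
  proof (rule ball_subset_image_ball)
    show "continuous_on (cball a r) f"
      using derf by (meson continuous_at_imp_continuous_on has_derivative_continuous)
    show "open (f ` ball a r)"
      using derf detf e by (intro open_image_of_invertible_derivative) auto
    show "2 * m / 3 \<le> dist (f a) (f x)" if x: "x \<in> sphere a r" for x
    proof -
      have "norm (e *\<^sub>R (x - a)) = m / 3"
        using x e by (simp add: dist_norm norm_minus_commute)
      moreover have "m \<le> norm (F x)"
        using m(2)[of "F x"] x by simp
      ultimately have "2 * m / 3 \<le> norm (f x)"
        using norm_diff_ineq[of "F x" "e *\<^sub>R (x - a)"] unfolding f_def by linarith
      then show ?thesis
        by (simp add: fa)
    qed
  qed (use r in auto)
  moreover have meas: "f ` ball a r \<in> lmeasurable"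
      "measure lebesgue (f ` ball a r) \<le> e ^ CARD('n) * measure lebesgue (ball a r)"
    using measurable_bounded_differentiable_image[of "ball a r" f f' "e ^ CARD('n)"]
      measure_bounded_differentiable_image[of "ball a r" f f' "e ^ CARD('n)"]
      has_derivative_at_withinI[OF derf] detf e
      integrable_on_const[of "ball a r"]
    by auto
  ultimately have "measure lebesgue (ball (f a) (2 * m / 3))
      \<le> e ^ CARD('n) * measure lebesgue (ball a r)"
    by (meson measure_mono_fmeasurable lmeasurable_ball fmeasurableD order_trans)
  then have "unit_ball_vol CARD('n) * (2 * m / 3) ^ CARD('n)
      \<le> unit_ball_vol CARD('n) * (m / 3) ^ CARD('n)"
    using m r by (simp add: content_ball mult_ac flip: e(2) power_mult_distrib)
  then have "(2 * m / 3) ^ CARD('n) \<le> (m / 3) ^ CARD('n)"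
    by (simp add: mult_le_cancel_left)
  then show False
    using m power_strict_mono[of "m / 3" "2 * m / 3" "CARD('n)"] by simp
qed

lemma complex_eigenvalue_iff_det:
  fixes A :: "real ^ 'n ^ 'n"
  shows "complex_eigenvalue A \<mu> \<longleftrightarrow> det (map_matrix complex_of_real A - mat \<mu>) = 0"
proof -
  let ?M = "map_matrix complex_of_real A"
  have "mat \<mu> *v v = \<mu> *s v" for v :: "complex ^ 'n"
    by (simp add: vec_eq_iff matrix_vector_mult_def mat_def if_distrib[of "\<lambda>c. c * _"] cong: if_cong)
  then have "complex_eigenvalue A \<mu> \<longleftrightarrow> (\<exists>v. v \<noteq> 0 \<and> (?M - mat \<mu>) *v v = 0)"
    by (simp add: complex_eigenvalue_def matrix_vector_mult_diff_rdistrib)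
  also have "\<dots> \<longleftrightarrow> \<not> invertible (?M - mat \<mu>)"
    using matrix_left_invertible_ker invertible_left_inverse by blast
  finally show ?thesis
    by (simp add: invertible_det_nz)
qed

text \<open>Both roots of the characteristic polynomial are eigenvalues, hence equal to \<open>1\<close>, so \<open>A\<close> has
  trace \<open>2\<close> and determinant \<open>1\<close>, and \<open>A - mat 1\<close> has trace and determinant \<open>0\<close>.\<close>

lemma det_shift_if_only_eigenvalue_1:
  fixes A :: "real ^ 2 ^ 2"
  assumes only: "\<And>\<mu>. complex_eigenvalue A \<mu> \<Longrightarrow> \<mu> = 1"
  shows "det (A - mat 1 + e *\<^sub>R mat 1) = e ^ 2"
proof -
  define t where "t = A $ 1 $ 1 + A $ 2 $ 2"
  have char: "complex_eigenvalue A \<mu> \<longleftrightarrow> \<mu> ^ 2 - of_real t * \<mu> + of_real (det A) = 0" for \<mu>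
    by (simp add: complex_eigenvalue_iff_det det_2 mat_def map_matrix_def t_def
        power2_eq_square algebra_simps)
  define \<mu> where "\<mu> = (of_real t + csqrt (of_real t ^ 2 - 4 * of_real (det A))) / 2"
  have root: "\<mu> ^ 2 - of_real t * \<mu> + of_real (det A) = 0"
  proof -
    have "(2 * \<mu> - of_real t) ^ 2 = of_real t ^ 2 - 4 * of_real (det A)"
      by (simp add: \<mu>_def field_simps)
    then have "4 * (\<mu> ^ 2 - of_real t * \<mu> + of_real (det A)) = 0"
      by (simp add: power2_eq_square algebra_simps)
    then show ?thesis
      unfolding mult_eq_0_iff by simp
  qed
  \<comment> \<open>The two roots of the characteristic polynomial add up to the trace.\<close>
  moreover have "(of_real t - \<mu>) ^ 2 - of_real t * (of_real t - \<mu>) + of_real (det A) = 0"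
    using root by (simp add: power2_eq_square algebra_simps)
  ultimately have "\<mu> = 1" "of_real t - \<mu> = 1"
    using only char by auto
  then have "complex_of_real t = of_real 2"
    by (simp add: algebra_simps)
  then have t: "t = 2"
    using of_real_eq_iff by blast
  moreover have "complex_of_real (det A) = of_real 1"
    using root \<open>\<mu> = 1\<close> t by simp
  then have "det A = 1"
    using of_real_eq_iff by blast
  moreover have "det (A - mat 1 + e *\<^sub>R mat 1) = det A - t + 1 + e * (t - 2) + e ^ 2"
    by (simp add: det_2 mat_def t_def power2_eq_square algebra_simps)
  ultimately show ?thesis
    by simp
qed

theorem theorem5p3:
  fixes G :: "real ^ 2 \<Rightarrow> real ^ 2"
  assumes "unipotent G"
    and "class_C1 G"
  shows "\<not> (\<exists>z. z isolated_in {z. G z = z})"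
proof -
  define J where "J = (\<lambda>z. jacobian G (at z))"
  have derG: "(G has_derivative (*v) (J z)) (at z)" for z
    using assms(1) jacobian_works unfolding unipotent_def J_def by blast
  have der: "((\<lambda>z. G z - z) has_derivative (*v) (J z - mat 1)) (at z)" for z
  proof -
    have "(*v) (J z - mat 1) = (\<lambda>h. J z *v h - h)"
      by (simp add: fun_eq_iff matrix_vector_mult_diff_rdistrib)
    then show ?thesis
      using has_derivative_diff[OF derG has_derivative_ident, of z] by simp
  qed
  have "complex_eigenvalue (J z) \<mu> \<Longrightarrow> \<mu> = 1" for z \<mu>
    using assms(1) unfolding unipotent_def Spc_def J_def by blast
  then have "det (matrix ((*v) (J z - mat 1)) + e *\<^sub>R mat 1) = e ^ CARD(2)" for z e
    using det_shift_if_only_eigenvalue_1 by simp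
  then have "\<not> z isolated_in {z. G z - z = 0}" for z
    using zero_not_isolated_if_derivative_nilpotent[OF der] by blast
  then show ?thesis
    by simp
qed

end
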